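(* Let $p$ be a prime and let $A(p)$ be the affine group over $\mathbb{Z}/p\mathbb{Z}$. The mixing time of the commuting chain on $A(p)$ satisfies \[\frac p4\le t_{mix}\le\left\lceil p\log(16)+2\right\rceil .\] Furthermore, the sequence of commuting chains on $A(p)$ (as $p\to\infty$ through the primes) does not exhibit cutoff.
   Context: $A(p)$ is the group, under matrix multiplication, of matrices $\begin{pmatrix}a&b\\0&1\end{pmatrix}$ with $a,b\in\mathbb{Z}/p\mathbb{Z}$, $a\ne0$. For a finite group $G$ and $x\in G$, let $C_x=\{h\in G: hx=xh\}$ and let $x^G$ be the conjugacy class of $x$. The commuting chain on $G$ is the Markov chain with state space $G$ and transition matrix $P(x,y)=\frac{1}{|C_x|}\mathbf 1_{\{xy=yx\}}$; its stationary distribution is $\pi(x)=\frac{1}{k|x^G|}$, where $k$ is the number of conjugacy classes of $G$. Total variation distance: $\Vert\mu-\nu\Vert_{TV}=\sup_{A}|\mu(A)-\nu(A)|$. Put $d(t)=\max_x\Vert P^t(x,\cdot)-\pi\Vert_{TV}$, $t_{mix}(\varepsilon)=\min\{t: d(t)\le\varepsilon\}$, and $t_{mix}=t_{mix}(1/4)$. A sequence of chains indexed by a parameter $n\to\infty$ with mixing times $t^{(n)}_{mix}(\varepsilon)$ exhibits cutoff if $\lim_{n\to\infty} t^{(n)}_{mix}(\varepsilon)/t^{(n)}_{mix}(1-\varepsilon)=1$ for all $\varepsilon\in(0,1)$. $\log$ is the natural logarithm. *)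

theory Defs
  imports "HOL-Analysis.Cartesian_Space" "HOL-Number_Theory.Residues"
begin

section \<open>Finite Markov chains\<close>

text \<open>
  A chain is given by a finite state space \<open>S\<close>, transition probabilities \<open>P x y\<close> and a
  stationary distribution \<open>\<pi>\<close>; only the values on \<open>S\<close> matter. Distributions
  on \<open>S\<close> are given by their point masses, so that \<open>\<mu>(A)\<close> is \<^term>\<open>sum \<mu> A\<close>.
\<close>

primrec transition_power :: "'a set \<Rightarrow> ('a \<Rightarrow> 'a \<Rightarrow> real) \<Rightarrow> nat \<Rightarrow> 'a \<Rightarrow> 'a \<Rightarrow> real" where
  "transition_power S P 0 = (\<lambda>x y. if x = y then 1 else 0)"
| "transition_power S P (Suc t) = (\<lambda>x y. \<Sum>z\<in>S. transition_power S P t x z * P z y)"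

definition tv_dist :: "'a set \<Rightarrow> ('a \<Rightarrow> real) \<Rightarrow> ('a \<Rightarrow> real) \<Rightarrow> real" where
  "tv_dist S \<mu> \<nu> = (SUP A\<in>Pow S. \<bar>sum \<mu> A - sum \<nu> A\<bar>)"

definition max_tv_dist :: "'a set \<Rightarrow> ('a \<Rightarrow> 'a \<Rightarrow> real) \<Rightarrow> ('a \<Rightarrow> real) \<Rightarrow> nat \<Rightarrow> real" where
  "max_tv_dist S P \<pi> t = Max ((\<lambda>x. tv_dist S (transition_power S P t x) \<pi>) ` S)"

text \<open>
  \<^term>\<open>Least\<close> returns an unspecified number if the distance never drops to \<open>\<epsilon>\<close>. This
  does not occur for \<open>\<epsilon> > 0\<close> and an irreducible aperiodic chain, such as the commuting
  chain on a finite group (all states communicate with \<open>\<one>\<close>, and \<open>P x x > 0\<close>).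
\<close>

definition mixing_time :: "'a set \<Rightarrow> ('a \<Rightarrow> 'a \<Rightarrow> real) \<Rightarrow> ('a \<Rightarrow> real) \<Rightarrow> real \<Rightarrow> nat" where
  "mixing_time S P \<pi> \<epsilon> = (LEAST t. max_tv_dist S P \<pi> t \<le> \<epsilon>)"

text \<open>
  In the next definition, \<open>t n \<epsilon>\<close> is the \<open>\<epsilon>\<close>-mixing time of the \<open>n\<close>-th chain of the sequence.
\<close>

definition exhibits_cutoff :: "(nat \<Rightarrow> real \<Rightarrow> nat) \<Rightarrow> bool" where
  "exhibits_cutoff t \<longleftrightarrow>
     (\<forall>\<epsilon>\<in>{0<..<1}. (\<lambda>n. real (t n \<epsilon>) / real (t n (1 - \<epsilon>))) \<longlonglongrightarrow> 1)"

section \<open>The commuting chain\<close>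

definition centralizer :: "('a, 'b) monoid_scheme \<Rightarrow> 'a \<Rightarrow> 'a set" where
  "centralizer G x = {h \<in> carrier G. h \<otimes>\<^bsub>G\<^esub> x = x \<otimes>\<^bsub>G\<^esub> h}"

definition conj_class :: "('a, 'b) monoid_scheme \<Rightarrow> 'a \<Rightarrow> 'a set" where
  "conj_class G x = {g \<otimes>\<^bsub>G\<^esub> x \<otimes>\<^bsub>G\<^esub> inv\<^bsub>G\<^esub> g | g. g \<in> carrier G}"

definition num_conj_classes :: "('a, 'b) monoid_scheme \<Rightarrow> nat" where
  "num_conj_classes G = card (conj_class G ` carrier G)"

definition commuting_transition :: "('a, 'b) monoid_scheme \<Rightarrow> 'a \<Rightarrow> 'a \<Rightarrow> real" where
  "commuting_transition G x y =
     1 / real (card (centralizer G x)) * (if x \<otimes>\<^bsub>G\<^esub> y = y \<otimes>\<^bsub>G\<^esub> x then 1 else 0)"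

definition commuting_stationary :: "('a, 'b) monoid_scheme \<Rightarrow> 'a \<Rightarrow> real" where
  "commuting_stationary G x = 1 / (real (num_conj_classes G) * real (card (conj_class G x)))"

definition commuting_mixing_time :: "('a, 'b) monoid_scheme \<Rightarrow> real \<Rightarrow> nat" where
  "commuting_mixing_time G =
     mixing_time (carrier G) (commuting_transition G) (commuting_stationary G)"

section \<open>The affine group\<close>

text \<open>
  \<^term>\<open>residue_ring (int p)\<close> is \<open>\<int>/p\<int>\<close> on the representatives \<open>{0..p - 1}\<close>, so matrices over
  it are integer matrices with entries in that range, multiplied in the residue ring.
\<close>

definition residue_mat_mult :: "nat \<Rightarrow> int^2^2 \<Rightarrow> int^2^2 \<Rightarrow> int^2^2" where
  "residue_mat_mult p A B =
     (\<chi> i j. \<Oplus>\<^bsub>residue_ring (int p)\<^esub>k\<in>UNIV. A $ i $ k \<otimes>\<^bsub>residue_ring (int p)\<^esub> B $ k $ j)"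

definition affine_mat :: "nat \<Rightarrow> int \<Rightarrow> int \<Rightarrow> int^2^2" where
  "affine_mat p a b =
     vector [vector [a, b],
             vector [\<zero>\<^bsub>residue_ring (int p)\<^esub>, \<one>\<^bsub>residue_ring (int p)\<^esub>]]"

definition affine_group :: "nat \<Rightarrow> (int^2^2) monoid" where
  "affine_group p =
     \<lparr>carrier = {affine_mat p a b | a b.
        a \<in> carrier (residue_ring (int p)) \<and> b \<in> carrier (residue_ring (int p)) \<and>
        a \<noteq> \<zero>\<^bsub>residue_ring (int p)\<^esub>},
      monoid.mult = residue_mat_mult p,
      monoid.one = affine_mat p \<one>\<^bsub>residue_ring (int p)\<^esub> \<zero>\<^bsub>residue_ring (int p)\<^esub>\<rparr>"

lemma residue_mat_mult_affine:
  assumes "prime p" "{a, b, c, d} \<subseteq> {0..int p - 1}"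
  shows "residue_mat_mult p (affine_mat p a b) (affine_mat p c d) =
           affine_mat p (a * c mod int p) ((a * d + b) mod int p)"
proof -
  have p: "1 < int p" using prime_gt_1_nat[OF assms(1)] by simp
  interpret residues "int p" "residue_ring (int p)" using p by unfold_locales simp_all
  have sum2: "(\<Oplus>\<^bsub>residue_ring (int p)\<^esub>k\<in>(UNIV :: 2 set). f k) = (f 1 + f 2) mod int p"
    if "f \<in> UNIV \<rightarrow> {0..int p - 1}" for f
  proof -
    have f: "f k \<in> carrier (residue_ring (int p))" for k
      using that by (auto simp: residue_ring_def)
    then have "(\<Oplus>\<^bsub>residue_ring (int p)\<^esub>k\<in>{1, 2 :: 2}. f k) =
        f 1 \<oplus>\<^bsub>residue_ring (int p)\<^esub> f 2"
      by simp
    then show ?thesis by (simp add: UNIV_2 residue_ring_def)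
  qed
  have e: "A $ i $ k * B $ k $ j mod int p \<in> {0..int p - 1}" for A B :: "int^2^2" and i j k
    using p by simp
  have m: "x \<otimes>\<^bsub>residue_ring (int p)\<^esub> y = x * y mod int p"
    and z: "\<zero>\<^bsub>residue_ring (int p)\<^esub> = 0" and o: "\<one>\<^bsub>residue_ring (int p)\<^esub> = 1" for x y
    by (simp_all add: residue_ring_def)
  show ?thesis
    unfolding residue_mat_mult_def m using p assms(2) e
    by (subst sum2) (auto simp: vec_eq_iff forall_2 affine_mat_def z o mod_simps)
qed

lemma carrier_affine_group:
  "carrier (affine_group p) = {affine_mat p a b | a b. a \<in> {1..int p - 1} \<and> b \<in> {0..int p - 1}}"
  unfolding affine_group_def residue_ring_def by force

lemma finite_affine_group: "finite (carrier (affine_group p))"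
proof -
  have "carrier (affine_group p) =
      (\<lambda>(a, b). affine_mat p a b) ` ({1..int p - 1} \<times> {0..int p - 1})"
    unfolding carrier_affine_group by (auto simp: image_iff) blast
  then show ?thesis by simp
qed

lemma group_affine_group:
  assumes "prime p"
  shows "group (affine_group p)"
proof -
  have p: "1 < int p" using prime_gt_1_nat[OF assms(1)] by simp
  have mlt: "x mod int p \<le> int p - 1" "0 \<le> x mod int p" for x
    using p by simp_all
  have mult: "affine_mat p a b \<otimes>\<^bsub>affine_group p\<^esub> affine_mat p c d =
      affine_mat p (a * c mod int p) ((a * d + b) mod int p)"
    if "a \<in> {1..int p - 1}" "b \<in> {0..int p - 1}" "c \<in> {1..int p - 1}" "d \<in> {0..int p - 1}"
    for a b c d
    using residue_mat_mult_affine[OF assms, of a b c d] that by (simp add: affine_group_def)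
  have one: "\<one>\<^bsub>affine_group p\<^esub> = affine_mat p 1 0"
    by (simp add: affine_group_def residue_ring_def)
  have unit: "a * c mod int p \<in> {1..int p - 1}"
    if "a \<in> {1..int p - 1}" "c \<in> {1..int p - 1}" for a c
  proof -
    have "\<not> int p dvd a" "\<not> int p dvd c" using that by (auto dest: zdvd_imp_le)
    then have "\<not> int p dvd a * c"
      using assms by (simp add: prime_dvd_mult_iff)
    then have "a * c mod int p \<noteq> 0" by (simp add: dvd_eq_mod_eq_0)
    then show ?thesis using mlt[of "a * c"] by auto
  qed
  show ?thesis
  proof (rule groupI)
    fix x y
    assume "x \<in> carrier (affine_group p)" "y \<in> carrier (affine_group p)"
    then obtain a b c d where
      "x = affine_mat p a b" "a \<in> {1..int p - 1}" "b \<in> {0..int p - 1}"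
      "y = affine_mat p c d" "c \<in> {1..int p - 1}" "d \<in> {0..int p - 1}"
      unfolding carrier_affine_group by blast
    moreover from this have "a * c mod int p \<in> {1..int p - 1}" using unit by blast
    moreover have "(a * d + b) mod int p \<in> {0..int p - 1}" using mlt by simp
    ultimately show "x \<otimes>\<^bsub>affine_group p\<^esub> y \<in> carrier (affine_group p)"
      unfolding carrier_affine_group using mult by blast
  next
    show "\<one>\<^bsub>affine_group p\<^esub> \<in> carrier (affine_group p)"
      unfolding carrier_affine_group one using p by fastforce
  next
    fix x y z
    assume "x \<in> carrier (affine_group p)" "y \<in> carrier (affine_group p)"
      "z \<in> carrier (affine_group p)"
    then obtain a b c d e f where
      x: "x = affine_mat p a b" "a \<in> {1..int p - 1}" "b \<in> {0..int p - 1}" and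
      y: "y = affine_mat p c d" "c \<in> {1..int p - 1}" "d \<in> {0..int p - 1}" and
      z: "z = affine_mat p e f" "e \<in> {1..int p - 1}" "f \<in> {0..int p - 1}"
      unfolding carrier_affine_group by blast
    have r: "v mod int p \<in> {0..int p - 1}" for v using mlt by simp
    have "a * c mod int p * e mod int p = a * (c * e mod int p) mod int p"
      by (simp add: mod_simps mult.assoc)
    moreover have "(a * c mod int p * f + (a * d + b) mod int p) mod int p =
        (a * ((c * f + d) mod int p) + b) mod int p"
    proof -
      have "(a * c mod int p * f + (a * d + b) mod int p) mod int p = (a * c * f + (a * d + b)) mod int p"
        by (metis mod_add_cong mod_mod_trivial mod_mult_left_eq)
      also have "\<dots> = (a * (c * f + d) + b) mod int p" by (simp add: algebra_simps)
      also have "\<dots> = (a * ((c * f + d) mod int p) + b) mod int p"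
        by (metis mod_add_left_eq mod_mult_right_eq)
      finally show ?thesis .
    qed
    ultimately show "x \<otimes>\<^bsub>affine_group p\<^esub> y \<otimes>\<^bsub>affine_group p\<^esub> z =
        x \<otimes>\<^bsub>affine_group p\<^esub> (y \<otimes>\<^bsub>affine_group p\<^esub> z)"
      unfolding x(1) y(1) z(1)
      using x(2,3) y(2,3) z(2,3) by (simp only: mult unit r)
  next
    fix x assume "x \<in> carrier (affine_group p)"
    then obtain a b where x: "x = affine_mat p a b" "a \<in> {1..int p - 1}" "b \<in> {0..int p - 1}"
      unfolding carrier_affine_group by blast
    then show "\<one>\<^bsub>affine_group p\<^esub> \<otimes>\<^bsub>affine_group p\<^esub> x = x"
      unfolding one using p by (simp add: mult)
    have "\<not> int p dvd a" using x(2) by (auto dest: zdvd_imp_le)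
    then have "coprime a (int p)"
      using assms by (metis coprime_commute prime_imp_coprime prime_nat_int_transfer)
    then obtain c0 where c0: "[a * c0 = 1] (mod int p)" by (meson cong_solve_coprime_int)
    define c where "c = c0 mod int p"
    have ac: "c * a mod int p = 1"
      using c0 p by (simp add: c_def cong_def mod_simps mult.commute)
    then have "c \<noteq> 0" by auto
    then have c: "c \<in> {1..int p - 1}" using mlt[of c0] by (auto simp: c_def)
    define d where "d = (- (c * b)) mod int p"
    have d: "d \<in> {0..int p - 1}" using mlt by (simp add: d_def)
    have "(c * b + d) mod int p = 0" by (simp add: d_def mod_simps)
    then have "affine_mat p c d \<otimes>\<^bsub>affine_group p\<^esub> x = \<one>\<^bsub>affine_group p\<^esub>"
      using x c d ac by (simp add: mult one)
    then show "\<exists>y\<in>carrier (affine_group p). y \<otimes>\<^bsub>affine_group p\<^esub> x = \<one>\<^bsub>affine_group p\<^esub>"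
      unfolding carrier_affine_group using c d by blast
  qed
qed

end

theory Submission
  imports Defs "HOL-Algebra.Group_Action"
begin

text \<open>
  Every \<open>x \<noteq> \<one>\<close> in \<open>A(p)\<close> has a centralizer of size at most \<open>p\<close>, so two steps of the chain
  dominate \<open>1 / p\<close> times the uniform distribution, and Doeblin's contraction gives
  \<open>d(2m) \<le> (1 - 1/p)\<^sup>m\<close>. Conversely the \<open>p - 1\<close> non-trivial translations form a set that the
  chain leaves with probability \<open>1 / p\<close> per step, whereas its stationary mass is \<open>1 / p\<close>; hence
  \<open>d(t) \<ge> (1 - 1/p)\<^sup>t - 1/p\<close>. Together,
  \<open>p (1 - \<epsilon>) - 1 \<le> t\<^sub>m\<^sub>i\<^sub>x(\<epsilon>) \<le> 2 \<lceil>p log (1/\<epsilon>)\<rceil>\<close>. For \<open>\<epsilon> = 1/10\<close> the lower bound on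
  \<open>t\<^sub>m\<^sub>i\<^sub>x(\<epsilon>)\<close> exceeds the upper bound on \<open>t\<^sub>m\<^sub>i\<^sub>x(1 - \<epsilon>)\<close> by a constant factor, so there is
  no cutoff.
\<close>

section \<open>Finite chains with a stationary distribution\<close>

locale stationary_chain =
  fixes S :: "'a set" and P :: "'a \<Rightarrow> 'a \<Rightarrow> real" and \<pi> :: "'a \<Rightarrow> real"
  assumes finite_states: "finite S"
    and nonempty: "S \<noteq> {}"
    and P_nonneg: "\<lbrakk>x \<in> S; y \<in> S\<rbrakk> \<Longrightarrow> 0 \<le> P x y"
    and P_sum: "x \<in> S \<Longrightarrow> (\<Sum>y\<in>S. P x y) = 1"
    and pi_nonneg: "x \<in> S \<Longrightarrow> 0 \<le> \<pi> x"
    and pi_sum: "(\<Sum>x\<in>S. \<pi> x) = 1"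
    and stationary: "y \<in> S \<Longrightarrow> (\<Sum>x\<in>S. \<pi> x * P x y) = \<pi> y"
begin

section \<open>Powers of the transition matrix\<close>

abbreviation "P_pow \<equiv> transition_power S P"

lemma power_nonneg: "\<lbrakk>x \<in> S; y \<in> S\<rbrakk> \<Longrightarrow> 0 \<le> P_pow t x y"
  by (induction t arbitrary: y) (auto intro!: sum_nonneg mult_nonneg_nonneg P_nonneg)

lemma power_sum: "x \<in> S \<Longrightarrow> (\<Sum>y\<in>S. P_pow t x y) = 1"
proof (induction t)
  case 0
  then show ?case using finite_states by simp
next
  case (Suc t)
  have "(\<Sum>y\<in>S. P_pow (Suc t) x y) = (\<Sum>z\<in>S. \<Sum>y\<in>S. P_pow t x z * P z y)"
    by (simp only: transition_power.simps) (rule sum.swap)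
  also have "\<dots> = (\<Sum>z\<in>S. P_pow t x z)"
    by (simp add: sum_distrib_left[symmetric] P_sum)
  finally show ?case using Suc by simp
qed

text \<open>Chapman-Kolmogorov. Since \<open>transition_power\<close> splits off the last step, the
  induction runs on \<open>t\<close> with \<open>y\<close> varying.\<close>

lemma power_add:
  assumes "y \<in> S"
  shows "P_pow (s + t) x y = (\<Sum>z\<in>S. P_pow s x z * P_pow t z y)"
  using assms
proof (induction t arbitrary: y)
  case 0
  then show ?case using finite_states by (simp add: if_distrib cong: if_cong)
next
  case (Suc t)
  have "P_pow (s + Suc t) x y = (\<Sum>w\<in>S. \<Sum>z\<in>S. P_pow s x z * P_pow t z w * P w y)"
    using Suc by (simp add: sum_distrib_right)
  also have "\<dots> = (\<Sum>z\<in>S. \<Sum>w\<in>S. P_pow s x z * P_pow t z w * P w y)"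
    by (rule sum.swap)
  finally show ?case by (simp add: sum_distrib_left mult.assoc)
qed

lemma power_stationary:
  assumes "y \<in> S"
  shows "(\<Sum>x\<in>S. \<pi> x * P_pow t x y) = \<pi> y"
  using assms
proof (induction t arbitrary: y)
  case 0
  then show ?case using finite_states by (simp add: if_distrib cong: if_cong)
next
  case (Suc t)
  have "(\<Sum>x\<in>S. \<pi> x * P_pow (Suc t) x y) = (\<Sum>x\<in>S. \<Sum>z\<in>S. \<pi> x * P_pow t x z * P z y)"
    by (simp add: sum_distrib_left mult.assoc)
  also have "\<dots> = (\<Sum>z\<in>S. \<Sum>x\<in>S. \<pi> x * P_pow t x z * P z y)"
    by (rule sum.swap)
  also have "\<dots> = (\<Sum>z\<in>S. \<pi> z * P z y)"
    using Suc.IH by (simp add: sum_distrib_right[symmetric])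
  finally show ?case using stationary Suc.prems by simp
qed

text \<open>
  Doeblin's argument: the common component \<open>\<delta> \<nu>\<close> of the rows of the \<open>s\<close>-step chain shifts the
  values of a function by a constant, so \<open>s\<close> steps shrink its oscillation by \<open>1 - \<delta>\<close>.
\<close>

lemma doeblin_oscillation:
  assumes "A \<subseteq> S"
    and nu_sum: "(\<Sum>y\<in>S. \<nu> y) = 1"
    and minor: "\<And>x y. \<lbrakk>x \<in> S; y \<in> S\<rbrakk> \<Longrightarrow> \<delta> * \<nu> y \<le> P_pow s x y"
  shows "\<exists>l. \<forall>x\<in>S. l \<le> sum (P_pow (s * m) x) A \<and> sum (P_pow (s * m) x) A \<le> l + (1 - \<delta>) ^ m"
proof (induction m)
  case 0
  have "finite A" using assms(1) finite_states finite_subset by blast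
  \<comment> \<open>In zero steps the probability of \<open>A\<close> is 0 or 1, so the interval
    from 0 to 1 serves.\<close>
  then show ?case by (intro exI[of _ 0]) simp
next
  case (Suc m)
  define f where "f x = sum (P_pow (s * m) x) A" for x
  define c where "c = (1 - \<delta>) ^ m"
  from Suc obtain l where l: "\<And>x. x \<in> S \<Longrightarrow> l \<le> f x" "\<And>x. x \<in> S \<Longrightarrow> f x \<le> l + c"
    unfolding f_def c_def by blast
  \<comment> \<open>Removing the common component leaves a nonnegative kernel of row mass
    \<open>1 - \<delta>\<close>.\<close>
  define R where "R x y = P_pow s x y - \<delta> * \<nu> y" for x y
  have R_nonneg: "0 \<le> R x y" if "x \<in> S" "y \<in> S" for x y
    using minor that by (simp add: R_def)
  have R_sum: "(\<Sum>y\<in>S. R x y) = 1 - \<delta>" if "x \<in> S" for x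
    using that power_sum nu_sum by (simp add: R_def sum_subtractf sum_distrib_left[symmetric])
  \<comment> \<open>The first summand does not depend on \<open>x\<close>, so only the
    \<open>R\<close> term contributes to the oscillation.\<close>
  have step: "sum (P_pow (s * Suc m) x) A = \<delta> * (\<Sum>z\<in>S. \<nu> z * f z) + (\<Sum>z\<in>S. R x z * f z)"
    if "x \<in> S" for x
  proof -
    have "sum (P_pow (s * Suc m) x) A = (\<Sum>y\<in>A. \<Sum>z\<in>S. P_pow s x z * P_pow (s * m) z y)"
      using assms(1) by (intro sum.cong) (auto simp: power_add)
    also have "\<dots> = (\<Sum>z\<in>S. P_pow s x z * f z)"
      by (subst sum.swap) (simp add: f_def sum_distrib_left)
    finally show ?thesis
      by (simp add: R_def algebra_simps sum_subtractf sum_distrib_left)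
  qed
  have lower: "(1 - \<delta>) * l \<le> (\<Sum>z\<in>S. R x z * f z)" if "x \<in> S" for x
  proof -
    have "(1 - \<delta>) * l = (\<Sum>z\<in>S. R x z * l)" using R_sum that by (simp add: sum_distrib_right[symmetric])
    also have "\<dots> \<le> (\<Sum>z\<in>S. R x z * f z)"
      using R_nonneg l that by (intro sum_mono mult_left_mono) auto
    finally show ?thesis .
  qed
  have upper: "(\<Sum>z\<in>S. R x z * f z) \<le> (1 - \<delta>) * (l + c)" if "x \<in> S" for x
  proof -
    have "(\<Sum>z\<in>S. R x z * f z) \<le> (\<Sum>z\<in>S. R x z * (l + c))"
      using R_nonneg l that by (intro sum_mono mult_left_mono) auto
    also have "\<dots> = (1 - \<delta>) * (l + c)" using R_sum that by (simp add: sum_distrib_right[symmetric])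
    finally show ?thesis .
  qed
  show ?case
    using step lower upper
    by (intro exI[of _ "\<delta> * (\<Sum>z\<in>S. \<nu> z * f z) + (1 - \<delta>) * l"]) (auto simp: c_def algebra_simps)
qed

text \<open>By stationarity \<open>sum \<pi> A\<close> is a \<open>\<pi>\<close>-average of the
  probabilities of \<open>A\<close> from the various starting states, so it lies in the same short
  interval as they do.\<close>

lemma max_tv_dist_doeblin:
  assumes "(\<Sum>y\<in>S. \<nu> y) = 1"
    and "\<And>x y. \<lbrakk>x \<in> S; y \<in> S\<rbrakk> \<Longrightarrow> \<delta> * \<nu> y \<le> P_pow s x y"
  shows "max_tv_dist S P \<pi> (s * m) \<le> (1 - \<delta>) ^ m"
proof -
  have "\<bar>sum (P_pow (s * m) x) A - sum \<pi> A\<bar> \<le> (1 - \<delta>) ^ m" if x: "x \<in> S" and A: "A \<subseteq> S" for x A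
  proof -
    from doeblin_oscillation[OF A assms, of m] obtain l where
      l: "\<And>x. x \<in> S \<Longrightarrow> l \<le> sum (P_pow (s * m) x) A"
         "\<And>x. x \<in> S \<Longrightarrow> sum (P_pow (s * m) x) A \<le> l + (1 - \<delta>) ^ m"
      by blast
    have "sum \<pi> A = (\<Sum>y\<in>A. \<Sum>z\<in>S. \<pi> z * P_pow (s * m) z y)"
      using A by (intro sum.cong) (auto simp: power_stationary)
    also have "\<dots> = (\<Sum>z\<in>S. \<pi> z * sum (P_pow (s * m) z) A)"
      by (subst sum.swap) (simp add: sum_distrib_left)
    finally have pi: "sum \<pi> A = (\<Sum>z\<in>S. \<pi> z * sum (P_pow (s * m) z) A)" .
    have "(\<Sum>z\<in>S. \<pi> z * l) \<le> sum \<pi> A"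
      unfolding pi using pi_nonneg l by (intro sum_mono mult_left_mono) auto
    moreover have "sum \<pi> A \<le> (\<Sum>z\<in>S. \<pi> z * (l + (1 - \<delta>) ^ m))"
      unfolding pi using pi_nonneg l by (intro sum_mono mult_left_mono) auto
    ultimately have "l \<le> sum \<pi> A" "sum \<pi> A \<le> l + (1 - \<delta>) ^ m"
      using pi_sum by (simp_all add: sum_distrib_right[symmetric])
    then show ?thesis using l[OF x] by linarith
  qed
  then have "tv_dist S (P_pow (s * m) x) \<pi> \<le> (1 - \<delta>) ^ m" if "x \<in> S" for x
    unfolding tv_dist_def using that by (intro cSUP_least) auto
  then show ?thesis
    unfolding max_tv_dist_def using finite_states nonempty by simp
qed

section \<open>Lower bounds on the distance from a single event\<close>

lemma le_max_tv_dist: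
  assumes "x \<in> S" "A \<subseteq> S"
  shows "sum (P_pow t x) A - sum \<pi> A \<le> max_tv_dist S P \<pi> t"
proof -
  have "sum (P_pow t x) A - sum \<pi> A \<le> \<bar>sum (P_pow t x) A - sum \<pi> A\<bar>" by simp
  also have "\<dots> \<le> tv_dist S (P_pow t x) \<pi>"
    unfolding tv_dist_def using assms finite_states
    by (intro cSUP_upper bdd_above_finite) auto
  also have "\<dots> \<le> max_tv_dist S P \<pi> t"
    unfolding max_tv_dist_def using assms finite_states by simp
  finally show ?thesis .
qed

text \<open>Each step keeps at least the fraction \<open>r\<close> of the mass currently in
  \<open>A\<close>; mass entering from outside only helps.\<close>

lemma power_stay:
  assumes "x \<in> A" "A \<subseteq> S" "0 \<le> r"
    and stay: "\<And>z. z \<in> A \<Longrightarrow> r \<le> (\<Sum>y\<in>A. P z y)"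
  shows "r ^ t \<le> sum (P_pow t x) A"
proof (induction t)
  case 0
  have "finite A" using assms finite_states finite_subset by blast
  then show ?case using assms by simp
next
  case (Suc t)
  have xS: "x \<in> S" using assms by blast
  have "r ^ Suc t \<le> (\<Sum>z\<in>A. P_pow t x z) * r"
    using Suc assms(3) by (simp add: mult.commute mult_left_mono)
  also have "\<dots> = (\<Sum>z\<in>A. P_pow t x z * r)" by (simp add: sum_distrib_right)
  also have "\<dots> \<le> (\<Sum>z\<in>A. P_pow t x z * (\<Sum>y\<in>A. P z y))"
    using stay power_nonneg xS assms(2) by (intro sum_mono mult_left_mono) auto
  also have "\<dots> = (\<Sum>z\<in>A. \<Sum>y\<in>A. P_pow t x z * P z y)" by (simp add: sum_distrib_left)
  also have "\<dots> = (\<Sum>y\<in>A. \<Sum>z\<in>A. P_pow t x z * P z y)" by (rule sum.swap)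
  also have "\<dots> \<le> (\<Sum>y\<in>A. \<Sum>z\<in>S. P_pow t x z * P z y)"
    using assms(2) xS finite_states
    by (intro sum_mono sum_mono2) (auto intro!: mult_nonneg_nonneg power_nonneg P_nonneg)
  finally show ?case by simp
qed

end

section \<open>The commuting chain of a finite group\<close>

context group
begin

section \<open>Centralizers and conjugacy classes\<close>

lemma centralizer_subset: "centralizer G x \<subseteq> carrier G"
  by (auto simp: centralizer_def)

lemma one_in_centralizer: "x \<in> carrier G \<Longrightarrow> \<one> \<in> centralizer G x"
  by (simp add: centralizer_def)

lemma card_centralizer_pos:
  "\<lbrakk>finite (carrier G); x \<in> carrier G\<rbrakk> \<Longrightarrow> 0 < card (centralizer G x)"
  using one_in_centralizer centralizer_subset by (metis card_gt_0_iff empty_iff finite_subset)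

text \<open>Orbit-stabilizer theorem for the action by conjugation.\<close>

lemma card_conj_class_centralizer:
  assumes "x \<in> carrier G"
  shows "card (conj_class G x) * card (centralizer G x) = order G"
proof -
  let ?\<phi> = "\<lambda>g. \<lambda>h\<in>carrier G. g \<otimes> h \<otimes> inv g"
  interpret group_action G "carrier G" ?\<phi> by (rule action_by_conjugation)
  have "orbit G ?\<phi> x = conj_class G x"
    using assms by (simp add: orbit_def conj_class_def)
  moreover have "g \<otimes> x \<otimes> inv g = x \<longleftrightarrow> g \<otimes> x = x \<otimes> g" if "g \<in> carrier G" for g
    using that assms by (metis inv_solve_right m_closed)
  then have "stabilizer G ?\<phi> x = centralizer G x"
    using assms by (auto simp: stabilizer_def centralizer_def)
  ultimately show ?thesis using orbit_stabilizer_theorem[OF assms] by simp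
qed

lemma conj_class_subset: "x \<in> carrier G \<Longrightarrow> conj_class G x \<subseteq> carrier G"
  by (auto simp: conj_class_def)

lemma self_in_conj_class: "x \<in> carrier G \<Longrightarrow> x \<in> conj_class G x"
  unfolding conj_class_def by (auto intro!: exI[of _ "\<one>"])

lemma conj_class_sym:
  assumes "x \<in> carrier G" "y \<in> conj_class G x"
  shows "x \<in> conj_class G y"
proof -
  obtain g where g: "g \<in> carrier G" "y = g \<otimes> x \<otimes> inv g"
    using assms(2) by (auto simp: conj_class_def)
  then have "x = inv g \<otimes> y \<otimes> inv (inv g)"
    using assms(1) by (simp add: m_assoc inv_solve_left)
  then show ?thesis using g unfolding conj_class_def by blast
qed

lemma conj_class_trans:
  assumes "x \<in> carrier G" "y \<in> conj_class G x"
  shows "conj_class G y \<subseteq> conj_class G x"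
proof
  fix z assume "z \<in> conj_class G y"
  then obtain h where h: "h \<in> carrier G" "z = h \<otimes> y \<otimes> inv h"
    by (auto simp: conj_class_def)
  obtain g where g: "g \<in> carrier G" "y = g \<otimes> x \<otimes> inv g"
    using assms(2) by (auto simp: conj_class_def)
  have "z = (h \<otimes> g) \<otimes> x \<otimes> inv (h \<otimes> g)"
    using h g assms(1) by (simp add: inv_mult_group m_assoc)
  then show "z \<in> conj_class G x" using h g unfolding conj_class_def by blast
qed

lemma conj_class_eq_iff:
  assumes "x \<in> carrier G" "y \<in> carrier G"
  shows "conj_class G y = conj_class G x \<longleftrightarrow> y \<in> conj_class G x"
  using assms conj_class_trans conj_class_sym self_in_conj_class by (metis subset_antisym)

text \<open>The elements of one class have total weight 1, so the sum counts classes. This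
  normalizes the stationary distribution.\<close>

lemma sum_inverse_card_conj_class:
  assumes "finite (carrier G)"
  shows "(\<Sum>x\<in>carrier G. 1 / real (card (conj_class G x))) = real (num_conj_classes G)"
proof -
  have "(\<Sum>x\<in>carrier G. 1 / real (card (conj_class G x))) =
      (\<Sum>c\<in>conj_class G ` carrier G.
         \<Sum>x\<in>{x \<in> carrier G. conj_class G x = c}. 1 / real (card (conj_class G x)))"
    by (rule sum.image_gen[OF assms])
  also have "\<dots> = (\<Sum>c\<in>conj_class G ` carrier G. 1)"
  proof (rule sum.cong)
    fix c assume "c \<in> conj_class G ` carrier G"
    then obtain x where x: "x \<in> carrier G" "c = conj_class G x" by blast
    have "{y \<in> carrier G. conj_class G y = c} = c"
      using x conj_class_eq_iff conj_class_subset by blast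
    then have "(\<Sum>y\<in>{y \<in> carrier G. conj_class G y = c}. 1 / real (card (conj_class G y))) =
        real (card c) * (1 / real (card c))"
      by (metis (mono_tags, lifting) mem_Collect_eq sum_constant sum.cong)
    moreover have "card c \<noteq> 0"
      using x self_in_conj_class conj_class_subset assms by (metis card_eq_0_iff empty_iff finite_subset)
    ultimately show "(\<Sum>y\<in>{y \<in> carrier G. conj_class G y = c}. 1 / real (card (conj_class G y))) = 1"
      by simp
  qed simp
  finally show ?thesis by (simp add: num_conj_classes_def)
qed

section \<open>Stationarity and the upper bound on the distance\<close>

lemma num_conj_classes_pos: "finite (carrier G) \<Longrightarrow> 0 < num_conj_classes G"
  unfolding num_conj_classes_def by (simp add: card_gt_0_iff) (use one_closed in blast)

text \<open>Orbit-stabilizer turns the class size into a centralizer size, which will cancel against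
  the normalizing factor of the transition probability.\<close>

lemma commuting_stationary_eq:
  assumes "finite (carrier G)" "x \<in> carrier G"
  shows "commuting_stationary G x =
    real (card (centralizer G x)) / (real (num_conj_classes G) * real (order G))"
proof -
  have "real (order G) = real (card (conj_class G x)) * real (card (centralizer G x))"
    using card_conj_class_centralizer[OF assms(2)] by (metis of_nat_mult)
  then show ?thesis
    using card_centralizer_pos[OF assms] by (simp add: commuting_stationary_def)
qed

lemma commuting_chain:
  assumes fin: "finite (carrier G)"
  shows "stationary_chain (carrier G) (commuting_transition G) (commuting_stationary G)"
proof
  show "finite (carrier G)" by fact
  show "carrier G \<noteq> {}" using one_closed by blast
  show "0 \<le> commuting_transition G x y" for x y
    by (simp add: commuting_transition_def)
  show "0 \<le> commuting_stationary G x" for x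
    by (simp add: commuting_stationary_def)
  show "(\<Sum>y\<in>carrier G. commuting_transition G x y) = 1" if "x \<in> carrier G" for x
  proof -
    have "(\<Sum>y\<in>carrier G. commuting_transition G x y) =
        (\<Sum>y\<in>centralizer G x. 1 / real (card (centralizer G x)))"
      by (rule sum.mono_neutral_cong_right)
        (use fin in \<open>auto simp: centralizer_def commuting_transition_def\<close>)
    then show ?thesis using card_centralizer_pos[OF fin that] by simp
  qed
  show "(\<Sum>x\<in>carrier G. commuting_stationary G x) = 1"
  proof -
    have "(\<Sum>x\<in>carrier G. commuting_stationary G x) =
        (\<Sum>x\<in>carrier G. 1 / real (card (conj_class G x))) / real (num_conj_classes G)"
      by (simp add: commuting_stationary_def sum_divide_distrib mult.commute)
    then show ?thesis
      using sum_inverse_card_conj_class[OF fin] num_conj_classes_pos[OF fin] by simp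
  qed
  show "(\<Sum>x\<in>carrier G. commuting_stationary G x * commuting_transition G x y) =
      commuting_stationary G y" if y: "y \<in> carrier G" for y
  proof -
    \<comment> \<open>After the cancellation every state that commutes with \<open>y\<close> sends
      it the same mass.\<close>
    have "(\<Sum>x\<in>carrier G. commuting_stationary G x * commuting_transition G x y) =
        (\<Sum>x\<in>centralizer G y. 1 / (real (num_conj_classes G) * real (order G)))"
    proof (rule sum.mono_neutral_cong_right)
      fix x assume x: "x \<in> centralizer G y"
      then have "x \<in> carrier G" "x \<otimes> y = y \<otimes> x" by (auto simp: centralizer_def)
      then show "commuting_stationary G x * commuting_transition G x y =
          1 / (real (num_conj_classes G) * real (order G))"
        using card_centralizer_pos[OF fin, of x]
        by (simp add: commuting_stationary_eq fin commuting_transition_def)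
    qed (use fin in \<open>auto simp: centralizer_def commuting_transition_def\<close>)
    then show ?thesis by (simp add: commuting_stationary_eq fin y)
  qed
qed

text \<open>
  A path from \<open>x \<noteq> \<one>\<close> to \<open>y\<close> through \<open>\<one>\<close>, and a path from \<open>\<one>\<close> to \<open>y\<close> through some
  \<open>z \<noteq> \<one>\<close> that commutes with \<open>y\<close>, both have probability at least \<open>1 / (c |G|)\<close>.
\<close>

lemma two_step_minorization:
  assumes fin: "finite (carrier G)" and nontriv: "1 < order G"
    and c: "\<And>x. \<lbrakk>x \<in> carrier G; x \<noteq> \<one>\<rbrakk> \<Longrightarrow> card (centralizer G x) \<le> c"
    and x: "x \<in> carrier G" and y: "y \<in> carrier G"
  shows "1 / real c * (1 / real (order G))
    \<le> transition_power (carrier G) (commuting_transition G) 2 x y"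
proof -
  let ?P = "commuting_transition G"
  interpret stationary_chain "carrier G" ?P "commuting_stationary G"
    by (rule commuting_chain[OF fin])
  \<comment> \<open>The zeroth power is a point mass at \<open>x\<close>, which collapses the inner
    sum.\<close>
  have two: "transition_power (carrier G) ?P 2 x y = (\<Sum>z\<in>carrier G. ?P x z * ?P z y)"
    using fin x by (simp add: numeral_2_eq_2 if_distrib[of "\<lambda>u. u * _"] cong: if_cong)
  have path: "?P x z * ?P z y \<le> transition_power (carrier G) ?P 2 x y" if "z \<in> carrier G" for z
    unfolding two using fin that x y
    by (intro member_le_sum[where f = "\<lambda>z. ?P x z * ?P z y"]) (auto simp: P_nonneg)
  have P_ge: "1 / real c \<le> ?P u v"
    if "u \<in> carrier G" "u \<noteq> \<one>" "u \<otimes> v = v \<otimes> u" for u v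
    using that c[of u] card_centralizer_pos[OF fin, of u]
    by (simp add: commuting_transition_def frac_le)
  have "centralizer G \<one> = carrier G" by (auto simp: centralizer_def)
  then have P_one: "?P \<one> v = 1 / real (order G)" if "v \<in> carrier G" for v
    using that by (simp add: commuting_transition_def order_def)
  show ?thesis
  proof (cases "x = \<one>")
    case False
    have "1 / real c * (1 / real (order G)) \<le> ?P x \<one> * ?P \<one> y"
      using P_ge[of x \<one>] P_one y x False by (intro mult_mono) (auto simp: P_nonneg)
    then show ?thesis using path[of \<one>] by simp
  next
    case True
    \<comment> \<open>\<open>y\<close> itself serves as \<open>z\<close>, unless \<open>y\<close> is
      the identity, with which everything commutes.\<close>
    obtain z where z: "z \<in> carrier G" "z \<noteq> \<one>" "z \<otimes> y = y \<otimes> z"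
    proof (cases "y = \<one>")
      case True
      have "carrier G \<noteq> {\<one>}" using nontriv by (auto simp: order_def)
      then obtain z where "z \<in> carrier G" "z \<noteq> \<one>" using one_closed by blast
      then show ?thesis using that True by auto
    qed (use y that in blast)
    have "1 / real (order G) * (1 / real c) \<le> ?P x z * ?P z y"
      using P_ge[OF z] P_one[OF z(1)] True x by (intro mult_mono) (auto simp: P_nonneg)
    then show ?thesis using path[OF z(1)] by (simp add: mult.commute)
  qed
qed

text \<open>Doeblin's bound with \<open>s = 2\<close>, \<open>\<delta> = 1 / c\<close> and the
  uniform distribution as \<open>\<nu>\<close>.\<close>

lemma commuting_max_tv_dist_le:
  assumes "finite (carrier G)" "1 < order G"
    and "\<And>x. \<lbrakk>x \<in> carrier G; x \<noteq> \<one>\<rbrakk> \<Longrightarrow> card (centralizer G x) \<le> c"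
  shows "max_tv_dist (carrier G) (commuting_transition G) (commuting_stationary G) (2 * m)
    \<le> (1 - 1 / real c) ^ m"
proof -
  interpret stationary_chain "carrier G" "commuting_transition G" "commuting_stationary G"
    by (rule commuting_chain[OF assms(1)])
  show ?thesis
    using assms two_step_minorization
    by (intro max_tv_dist_doeblin[where \<nu> = "\<lambda>_. 1 / real (order G)"]) (auto simp: order_def)
qed

end

section \<open>The affine group\<close>

lemma affine_mat_entries:
  "affine_mat p a b $ 1 $ 1 = a" "affine_mat p a b $ 1 $ 2 = b"
  by (simp_all add: affine_mat_def)

lemma affine_mat_eq_iff: "affine_mat p a b = affine_mat p c d \<longleftrightarrow> a = c \<and> b = d"
  by (metis affine_mat_entries)

lemma one_affine_group: "\<one>\<^bsub>affine_group p\<^esub> = affine_mat p 1 0"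
  by (simp add: affine_group_def residue_ring_def)

lemma order_affine_group: "order (affine_group p) = (p - 1) * p"
proof -
  have "carrier (affine_group p) =
      (\<lambda>(a, b). affine_mat p a b) ` ({1..int p - 1} \<times> {0..int p - 1})"
    unfolding carrier_affine_group by (auto simp: image_iff) blast
  moreover have "inj_on (\<lambda>(a, b). affine_mat p a b) ({1..int p - 1} \<times> {0..int p - 1})"
    by (auto simp: inj_on_def affine_mat_eq_iff)
  ultimately have "order (affine_group p) = card ({1..int p - 1} \<times> {0..int p - 1})"
    by (simp add: order_def card_image)
  then show ?thesis by (simp add: nat_diff_distrib')
qed

context
  fixes p :: nat
  assumes prime: "prime p"
begin

interpretation group "affine_group p"
  by (rule group_affine_group[OF prime])

section \<open>Commuting affine maps and their centralizers\<close>

lemma mult_affine: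
  assumes "a \<in> {1..int p - 1}" "b \<in> {0..int p - 1}" "c \<in> {1..int p - 1}" "d \<in> {0..int p - 1}"
  shows "affine_mat p a b \<otimes>\<^bsub>affine_group p\<^esub> affine_mat p c d =
    affine_mat p (a * c mod int p) ((a * d + b) mod int p)"
  using residue_mat_mult_affine[OF prime, of a b c d] assms by (simp add: affine_group_def)

text \<open>Both products have linear part \<open>a * c\<close> mod \<open>p\<close>, so only the
  translation parts have to be compared.\<close>

lemma affine_commute_iff:
  assumes "a \<in> {1..int p - 1}" "b \<in> {0..int p - 1}" "c \<in> {1..int p - 1}" "d \<in> {0..int p - 1}"
  shows "affine_mat p a b \<otimes>\<^bsub>affine_group p\<^esub> affine_mat p c d =
      affine_mat p c d \<otimes>\<^bsub>affine_group p\<^esub> affine_mat p a b \<longleftrightarrow>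
    int p dvd (a - 1) * d - (c - 1) * b"
proof -
  have "(a * d + b) mod int p = (c * b + d) mod int p \<longleftrightarrow> int p dvd (a * d + b) - (c * b + d)"
    by (rule mod_eq_dvd_iff)
  also have "(a * d + b) - (c * b + d) = (a - 1) * d - (c - 1) * b"
    by (simp add: algebra_simps)
  finally show ?thesis
    using assms by (simp add: mult_affine affine_mat_eq_iff mult.commute)
qed

lemma residue_eqI:
  assumes "int p dvd x - y" "x \<in> {0..int p - 1}" "y \<in> {0..int p - 1}"
  shows "x = y"
  using assms by (auto simp: mod_eq_dvd_iff[symmetric])

text \<open>Since \<open>b\<close> is invertible mod \<open>p\<close>, the commutation criterion
  \<open>int p dvd (a - 1) * b\<close> forces \<open>a = 1\<close>.\<close>

lemma centralizer_translation:
  assumes "b \<in> {1..int p - 1}"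
  shows "centralizer (affine_group p) (affine_mat p 1 b) = affine_mat p 1 ` {0..int p - 1}"
proof -
  have p: "1 < int p" using prime_gt_1_nat[OF prime] by simp
  have "a = 1" if "int p dvd (a - 1) * b" "a \<in> {1..int p - 1}" for a
  proof -
    have "\<not> int p dvd b" using assms by (auto dest: zdvd_imp_le)
    then have "int p dvd a - 1" using that prime by (simp add: prime_dvd_mult_iff)
    then show ?thesis using that(2) p by (intro residue_eqI) auto
  qed
  then have "affine_mat p a d \<otimes>\<^bsub>affine_group p\<^esub> affine_mat p 1 b =
      affine_mat p 1 b \<otimes>\<^bsub>affine_group p\<^esub> affine_mat p a d \<longleftrightarrow> a = 1"
    if "a \<in> {1..int p - 1}" "d \<in> {0..int p - 1}" for a d
    using that assms p by (subst affine_commute_iff) auto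
  then show ?thesis
    using p unfolding centralizer_def carrier_affine_group by (auto simp: affine_mat_eq_iff)
qed

lemma card_translations: "card (affine_mat p 1 ` {0..int p - 1}) = p"
  by (subst card_image) (auto simp: inj_on_def affine_mat_eq_iff)

text \<open>A non-trivial translation has the \<open>p\<close> translations as centralizer. If
  \<open>a \<noteq> 1\<close>, then \<open>a - 1\<close> is invertible mod \<open>p\<close>, and the
  criterion determines the translation part of a commuting element from its linear part.\<close>

lemma card_centralizer_le:
  assumes "x \<in> carrier (affine_group p)" "x \<noteq> \<one>\<^bsub>affine_group p\<^esub>"
  shows "card (centralizer (affine_group p) x) \<le> p"
proof -
  obtain a b where x: "x = affine_mat p a b" and ab: "a \<in> {1..int p - 1}" "b \<in> {0..int p - 1}"
    using assms(1) unfolding carrier_affine_group by blast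
  show ?thesis
  proof (cases "a = 1")
    case True
    then have "b \<noteq> 0" using assms(2) by (auto simp: x one_affine_group)
    then have "b \<in> {1..int p - 1}" using ab by auto
    then show ?thesis using centralizer_translation card_translations by (simp add: x True)
  next
    case False
    then have a: "\<not> int p dvd a - 1" using ab by (auto dest: zdvd_imp_le)
    have "inj_on (\<lambda>h. h $ 1 $ 1) (centralizer (affine_group p) x)"
    proof (rule inj_onI)
      fix g h assume gh: "g \<in> centralizer (affine_group p) x" "h \<in> centralizer (affine_group p) x"
        "g $ 1 $ 1 = h $ 1 $ 1"
      then obtain c d e where
        g: "g = affine_mat p c d" and h: "h = affine_mat p c e" and
        cde: "c \<in> {1..int p - 1}" "d \<in> {0..int p - 1}" "e \<in> {0..int p - 1}"
        unfolding centralizer_def carrier_affine_group by (auto simp: affine_mat_entries)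
      have "int p dvd (c - 1) * b - (a - 1) * d" "int p dvd (c - 1) * b - (a - 1) * e"
        using gh(1,2) ab cde unfolding g h x centralizer_def
        by (simp_all add: affine_commute_iff)
      then have "int p dvd ((c - 1) * b - (a - 1) * e) - ((c - 1) * b - (a - 1) * d)"
        by (rule dvd_diff[rotated])
      then have "int p dvd (a - 1) * (d - e)" by (simp add: algebra_simps)
      then have "int p dvd d - e" using a prime by (simp add: prime_dvd_mult_iff)
      then have "d = e" using cde by (intro residue_eqI)
      then show "g = h" by (simp add: g h)
    qed
    \<comment> \<open>Linear parts are nonzero, but the wider range with \<open>p\<close> elements
      gives the bound that translations attain.\<close>
    then have "card (centralizer (affine_group p) x) \<le> card {0..int p - 1}"
      by (rule card_inj_on_le)
        (auto simp: centralizer_def carrier_affine_group affine_mat_entries)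
    then show ?thesis by simp
  qed
qed

section \<open>Linear parts and the number of conjugacy classes\<close>

lemma mult_affine_entry:
  assumes "x \<in> carrier (affine_group p)" "y \<in> carrier (affine_group p)"
  shows "(x \<otimes>\<^bsub>affine_group p\<^esub> y) $ 1 $ 1 = x $ 1 $ 1 * y $ 1 $ 1 mod int p"
  using assms unfolding carrier_affine_group by (auto simp: mult_affine affine_mat_entries)

text \<open>The linear part is multiplicative with commuting values, so conjugation preserves it.
  Comparing \<open>y\<close> times \<open>g\<close> with \<open>g\<close> times \<open>x\<close>
  avoids computing an inverse.\<close>

lemma conj_class_entry:
  assumes "x \<in> carrier (affine_group p)" "y \<in> conj_class (affine_group p) x"
  shows "y $ 1 $ 1 = x $ 1 $ 1"
proof -
  obtain g where g: "g \<in> carrier (affine_group p)"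
    and y: "y = g \<otimes>\<^bsub>affine_group p\<^esub> x \<otimes>\<^bsub>affine_group p\<^esub> inv\<^bsub>affine_group p\<^esub> g"
    using assms(2) by (auto simp: conj_class_def)
  have yG: "y \<in> carrier (affine_group p)" using g assms(1) y by simp
  have "y \<otimes>\<^bsub>affine_group p\<^esub> g = g \<otimes>\<^bsub>affine_group p\<^esub> x"
    using g assms(1) by (simp add: y m_assoc)
  then have "y $ 1 $ 1 * g $ 1 $ 1 mod int p = g $ 1 $ 1 * x $ 1 $ 1 mod int p"
    using g yG assms(1) mult_affine_entry by metis
  then have "int p dvd g $ 1 $ 1 * (y $ 1 $ 1 - x $ 1 $ 1)"
    by (simp add: mod_eq_dvd_iff algebra_simps)
  moreover have entry: "h $ 1 $ 1 \<in> {1..int p - 1}" if "h \<in> carrier (affine_group p)" for h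
    using that unfolding carrier_affine_group by (auto simp: affine_mat_entries)
  have "\<not> int p dvd g $ 1 $ 1" using entry[OF g] by (auto dest: zdvd_imp_le)
  ultimately have "int p dvd y $ 1 $ 1 - x $ 1 $ 1" using prime by (simp add: prime_dvd_mult_iff)
  then show ?thesis using entry[OF yG] entry[OF assms(1)] by (intro residue_eqI) auto
qed

text \<open>The linear part separates the \<open>p - 1\<close> diagonal matrices, and a non-trivial
  translation gives one further class because the identity is alone in its own. The bound caps the
  stationary mass of the translations.\<close>

lemma num_conj_classes_ge: "p \<le> num_conj_classes (affine_group p)"
proof -
  have p: "1 < int p" using prime_gt_1_nat[OF prime] by simp
  define D where "D = (\<lambda>a. affine_mat p a 0) ` {1..int p - 1}"
  define R where "R = insert (affine_mat p 1 1) D"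
  have "card D = p - 1"
    unfolding D_def by (subst card_image) (auto simp: inj_on_def affine_mat_eq_iff nat_diff_distrib')
  then have "card R = p"
    using p by (simp add: R_def D_def image_iff affine_mat_eq_iff)
  have R: "R \<subseteq> carrier (affine_group p)"
    using p unfolding R_def D_def carrier_affine_group by fastforce
  have one: "y = \<one>\<^bsub>affine_group p\<^esub>" if "y \<in> conj_class (affine_group p) \<one>\<^bsub>affine_group p\<^esub>" for y
    using that by (auto simp: conj_class_def)
  have "inj_on (conj_class (affine_group p)) R"
  proof (rule inj_onI)
    fix x y assume xy: "x \<in> R" "y \<in> R"
      and eq: "conj_class (affine_group p) x = conj_class (affine_group p) y"
    have G: "x \<in> carrier (affine_group p)" "y \<in> carrier (affine_group p)" using R xy by auto
    have mem: "y \<in> conj_class (affine_group p) x" "x \<in> conj_class (affine_group p) y"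
      using eq G self_in_conj_class by auto
    then have "y $ 1 $ 1 = x $ 1 $ 1" using conj_class_entry G by blast
    \<comment> \<open>Two distinct representatives with equal linear part can only be the identity
      and \<open>affine_mat p 1 1\<close>.\<close>
    then consider "x = y" | "x = \<one>\<^bsub>affine_group p\<^esub>" | "y = \<one>\<^bsub>affine_group p\<^esub>"
      using xy by (auto simp: R_def D_def affine_mat_entries one_affine_group)
    then show "x = y" using mem one by cases auto
  qed
  then have "p = card (conj_class (affine_group p) ` R)"
    using \<open>card R = p\<close> by (simp add: card_image)
  also have "\<dots> \<le> num_conj_classes (affine_group p)"
    unfolding num_conj_classes_def using R finite_affine_group by (intro card_mono) auto
  finally show ?thesis .
qed

section \<open>Distance to stationarity on the affine group\<close>

interpretation stationary_chain "carrier (affine_group p)"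
  "commuting_transition (affine_group p)" "commuting_stationary (affine_group p)"
  by (rule commuting_chain[OF finite_affine_group])

abbreviation (input) dist_to_stationary :: "nat \<Rightarrow> real" where
  "dist_to_stationary \<equiv> max_tv_dist (carrier (affine_group p))
     (commuting_transition (affine_group p)) (commuting_stationary (affine_group p))"

lemma affine_dist_le: "dist_to_stationary (2 * m) \<le> (1 - 1 / real p) ^ m"
proof (rule commuting_max_tv_dist_le[OF finite_affine_group _ card_centralizer_le])
  have "1 \<le> p - 1" "2 \<le> p" using prime_ge_2_nat[OF prime] by auto
  then have "1 * 2 \<le> (p - 1) * p" by (rule mult_le_mono)
  then show "1 < order (affine_group p)" by (simp add: order_affine_group)
qed

lemma affine_dist_ge: "(1 - 1 / real p) ^ t - 1 / real p \<le> dist_to_stationary t"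
proof -
  have p: "1 < p" using prime_gt_1_nat[OF prime] .
  \<comment> \<open>From each non-trivial translation the chain moves uniformly over all
    \<open>p\<close> translations, so it stays in \<open>A\<close> with probability
    \<open>1 - 1 / p\<close>.\<close>
  define A where "A = affine_mat p 1 ` {1..int p - 1}"
  have A: "A \<subseteq> carrier (affine_group p)"
    using p unfolding A_def carrier_affine_group by fastforce
  have card_A: "card A = p - 1"
    unfolding A_def by (subst card_image) (auto simp: inj_on_def affine_mat_eq_iff nat_diff_distrib')
  have cent: "A \<subseteq> centralizer (affine_group p) z" "card (centralizer (affine_group p) z) = p"
    if "z \<in> A" for z
    using that centralizer_translation card_translations by (auto simp: A_def)
  have "(1 - 1 / real p) \<le> (\<Sum>y\<in>A. commuting_transition (affine_group p) z y)" if z: "z \<in> A" for z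
  proof -
    have "(\<Sum>y\<in>A. commuting_transition (affine_group p) z y) = (\<Sum>y\<in>A. 1 / real p)"
      using cent[OF z] by (intro sum.cong) (auto simp: commuting_transition_def centralizer_def)
    also have "\<dots> = 1 - 1 / real p"
      using p by (simp add: card_A of_nat_diff field_simps)
    finally show ?thesis by simp
  qed
  moreover have "affine_mat p 1 1 \<in> A" using p by (auto simp: A_def)
  ultimately have "(1 - 1 / real p) ^ t \<le> sum (P_pow t (affine_mat p 1 1)) A"
    using A p by (intro power_stay) auto
  moreover have "sum (commuting_stationary (affine_group p)) A \<le> 1 / real p"
  proof -
    let ?k = "real (num_conj_classes (affine_group p))"
    \<comment> \<open>All \<open>p - 1\<close> elements have centralizers of size \<open>p\<close>,
      hence equal mass; the total is one over the number of classes.\<close>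
    have "sum (commuting_stationary (affine_group p)) A =
        (\<Sum>x\<in>A. real p / (?k * real (order (affine_group p))))"
      using A cent by (intro sum.cong) (auto simp: commuting_stationary_eq finite_affine_group)
    also have "\<dots> = 1 / ?k"
      using p by (simp add: card_A order_affine_group)
    also have "\<dots> \<le> 1 / real p"
      using num_conj_classes_ge p by (intro divide_left_mono) auto
    finally show ?thesis .
  qed
  moreover have "sum (P_pow t (affine_mat p 1 1)) A - sum (commuting_stationary (affine_group p)) A
      \<le> dist_to_stationary t"
    using A \<open>affine_mat p 1 1 \<in> A\<close> by (intro le_max_tv_dist) auto
  ultimately show ?thesis by linarith
qed

text \<open>Follows from \<open>1 - 1 / p \<le> exp (- 1 / p)\<close>. It also shows that the
  minimum defining the mixing time exists.\<close>

lemma affine_dist_le_eps: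
  assumes "0 < \<epsilon>"
  shows "dist_to_stationary (2 * nat \<lceil>real p * ln (1 / \<epsilon>)\<rceil>) \<le> \<epsilon>"
proof -
  define m where "m = nat \<lceil>real p * ln (1 / \<epsilon>)\<rceil>"
  have p: "1 < p" using prime_gt_1_nat[OF prime] .
  have "dist_to_stationary (2 * m) \<le> (1 - 1 / real p) ^ m" by (rule affine_dist_le)
  also have "\<dots> \<le> exp (- 1 / real p) ^ m"
    using p exp_ge_add_one_self[of "- 1 / real p"] by (intro power_mono) auto
  also have "\<dots> = exp (- (real m / real p))"
    by (simp add: exp_of_nat_mult[symmetric])
  also have "\<dots> \<le> exp (ln \<epsilon>)"
  proof -
    \<comment> \<open>This holds also for \<open>\<epsilon> > 1\<close>, where \<open>nat\<close>
      truncates to 0.\<close>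
    have "real p * ln (1 / \<epsilon>) \<le> real m" unfolding m_def by linarith
    then have "ln (1 / \<epsilon>) \<le> real m / real p" using p by (simp add: field_simps)
    then have "- (real m / real p) \<le> ln \<epsilon>" using assms by (simp add: ln_div)
    then show ?thesis by (simp only: exp_le_cancel_iff)
  qed
  finally show ?thesis using assms by (simp add: m_def)
qed

section \<open>Mixing time bounds\<close>

lemma affine_mixing_time_le:
  assumes "0 < \<epsilon>"
  shows "commuting_mixing_time (affine_group p) \<epsilon> \<le> 2 * nat \<lceil>real p * ln (1 / \<epsilon>)\<rceil>"
  unfolding commuting_mixing_time_def mixing_time_def
  by (rule Least_le) (rule affine_dist_le_eps[OF assms])

text \<open>Bernoulli's inequality makes the lower bound on the distance linear in
  \<open>t\<close>.\<close>

lemma affine_mixing_time_ge: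
  assumes "0 < \<epsilon>"
  shows "real p * (1 - \<epsilon>) - 1 \<le> real (commuting_mixing_time (affine_group p) \<epsilon>)"
proof -
  define t where "t = commuting_mixing_time (affine_group p) \<epsilon>"
  have p: "1 < p" using prime_gt_1_nat[OF prime] .
  have "dist_to_stationary t \<le> \<epsilon>"
    unfolding t_def commuting_mixing_time_def mixing_time_def
    by (rule LeastI[where P = "\<lambda>t. dist_to_stationary t \<le> \<epsilon>"]) (rule affine_dist_le_eps[OF assms])
  moreover have "1 + real t * (- 1 / real p) \<le> (1 + - 1 / real p) ^ t"
    using p by (intro Bernoulli_inequality) auto
  ultimately have "1 - real t / real p - 1 / real p \<le> \<epsilon>"
    using affine_dist_ge[of t] by simp
  then have "real p * (1 - real t / real p - 1 / real p) \<le> real p * \<epsilon>"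
    by (intro mult_left_mono) auto
  then show ?thesis using p by (simp add: t_def algebra_simps)
qed

end

theorem theorem4p2:
  shows "(\<forall>p::nat. prime p \<longrightarrow>
            real p / 4 \<le> real (commuting_mixing_time (affine_group p) (1/4)) \<and>
            int (commuting_mixing_time (affine_group p) (1/4)) \<le> \<lceil>real p * ln 16 + 2\<rceil>) \<and>
         \<not> exhibits_cutoff (\<lambda>n. commuting_mixing_time (affine_group (enumerate {p. prime p} n)))"
proof (intro conjI allI impI)
  fix p :: nat assume p: "prime p"
  \<comment> \<open>The bound \<open>3 * p / 4 - 1\<close> is at least \<open>p / 4\<close> exactly
    when \<open>p \<ge> 2\<close>.\<close>
  then show "real p / 4 \<le> real (commuting_mixing_time (affine_group p) (1/4))"
    using affine_mixing_time_ge[OF p, of "1/4"] prime_ge_2_nat[OF p] by simp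
  let ?m = "nat \<lceil>real p * ln 4\<rceil>"
  have "commuting_mixing_time (affine_group p) (1/4) \<le> 2 * ?m"
    using affine_mixing_time_le[OF p, of "1/4"] by simp
  moreover have "real (2 * ?m) \<le> real p * ln 16 + 2"
  proof -
    \<comment> \<open>The two steps per round turn \<open>ln 4\<close> into \<open>ln 16\<close> and
      the rounding error 1 into 2.\<close>
    have "real p * ln 16 = 2 * (real p * ln 4)" using ln_realpow[of 4 2] by simp
    moreover have "0 \<le> real p * ln 4" by simp
    then have "real ?m \<le> real p * ln 4 + 1" by linarith
    ultimately show ?thesis by linarith
  qed
  ultimately show "int (commuting_mixing_time (affine_group p) (1/4)) \<le> \<lceil>real p * ln 16 + 2\<rceil>"
    by linarith
next
  let ?q = "enumerate {p::nat. prime p}"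
  let ?t = "\<lambda>n. commuting_mixing_time (affine_group (?q n))"
  show "\<not> exhibits_cutoff ?t"
  proof
    assume "exhibits_cutoff ?t"
    then have "(\<lambda>n. real (?t n (1/10)) / real (?t n (1 - 1/10))) \<longlonglongrightarrow> 1"
      unfolding exhibits_cutoff_def by (rule bspec) simp
    then have "(\<lambda>n. real (?t n (1/10)) / real (?t n (9/10))) \<longlonglongrightarrow> 1" by simp
    \<comment> \<open>The threshold lies between the supposed limit 1 and \<open>81/20\<close>, the
      quotient of the leading terms \<open>9 * q / 10\<close> and \<open>2 * q / 9\<close> of the
      two bounds.\<close>
    then have "\<forall>\<^sub>F n in sequentially. real (?t n (1/10)) / real (?t n (9/10)) < 3/2"
      by (rule order_tendstoD) simp
    then obtain N where N: "\<And>n. N \<le> n \<Longrightarrow> real (?t n (1/10)) / real (?t n (9/10)) < 3/2"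
      unfolding eventually_sequentially by blast
    \<comment> \<open>As \<open>?q n \<ge> n\<close>, this gives a prime \<open>q \<ge> 11\<close>,
      so that \<open>q / 10 - 1\<close> is positive, which keeps the denominator nonzero, and
      \<open>3/2 * (2 * q / 9 + 2) \<le> 9 * q / 10 - 1\<close>.\<close>
    define n where "n = max N 11"
    have n: "11 \<le> n" and ratio: "real (?t n (1/10)) / real (?t n (9/10)) < 3/2"
      using N by (simp_all add: n_def)
    have inf: "infinite {p::nat. prime p}" by (rule primes_infinite)
    have p: "prime (?q n)" using enumerate_in_set[OF inf] by simp
    have large: "11 \<le> ?q n" using le_enumerate[OF inf, of n] n by linarith
    \<comment> \<open>The estimate \<open>ln x \<le> x - 1\<close> at \<open>x = 10/9\<close> yields
      the coefficient \<open>1/9\<close>.\<close>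
    have "real (?q n) * ln (10/9) \<le> real (?q n) * (1/9)"
      using ln_le_minus_one[of "10/9"] by (intro mult_left_mono) auto
    moreover have "0 \<le> real (?q n) * ln (10/9)" by simp
    ultimately have "real (nat \<lceil>real (?q n) * ln (10/9)\<rceil>) \<le> real (?q n) / 9 + 1" by linarith
    moreover have "?t n (9/10) \<le> 2 * nat \<lceil>real (?q n) * ln (10/9)\<rceil>"
      using affine_mixing_time_le[OF p, of "9/10"] by simp
    ultimately have "real (?t n (9/10)) \<le> 2 * real (?q n) / 9 + 2" by linarith
    moreover have "real (?q n) / 10 - 1 \<le> real (?t n (9/10))"
      using affine_mixing_time_ge[OF p, of "9/10"] by simp
    moreover have "9 * real (?q n) / 10 - 1 \<le> real (?t n (1/10))"
      using affine_mixing_time_ge[OF p, of "1/10"] by simp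
    moreover have "11 \<le> real (?q n)" using large by linarith
    ultimately have "0 < real (?t n (9/10))" "3/2 * real (?t n (9/10)) \<le> real (?t n (1/10))"
      by linarith+
    then show False using ratio by (simp add: field_simps)
  qed
qed

end
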